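(* Let $0\leqslant\alpha<1$, $\beta>0$ and let $n\geqslant 1$ be an integer. Let $\mathcal{F}_{\alpha,\beta,n}$ be the family of all functions $F(z)=f(z)(Q(z))^{\beta/n}$ on $\mathbb{D}$, where $f\in\mathcal{ST}(\alpha)$ and $Q$ is a polynomial of degree $n$ with $Q(0)=1$ and all zeros in $\mathbb{C}\setminus\mathbb{D}$. Then the radius of starlikeness associated with the exponential function of this family, that is, the largest $R\in(0,1)$ such that $z\mapsto r^{-1}F(rz)$ belongs to $\mathcal{S}^{*}_{e}$ for all $F\in\mathcal{F}_{\alpha,\beta,n}$ and all $0<r<R$, is \[R_{\mathcal{S}^{*}_{e}}(F)=\begin{cases}\sigma_0 & \text{if } 2\alpha+\beta-2\geqslant 0,\\ \sigma_0 & \text{if } 2\alpha+\beta-2<0 \text{ and } X(\alpha,\beta)\leqslant 0,\\ \tilde{\sigma}_0 & \text{if } 2\alpha+\beta-2<0 \text{ and } X(\alpha,\beta)>0,\end{cases}\] where \[\sigma_0=\dfrac{2(e-1)}{e(2-2\alpha+\beta)+\sqrt{(e(2-2\alpha+\beta))^2-4(e-1)(1-e(2\alpha-1+\beta))}},\] \[\tilde{\sigma}_0=\dfrac{2(e-1)}{(2-2\alpha+\beta)+\sqrt{(2-2\alpha+\beta)^2-4(e-1)(2\alpha-1+\beta-e)}},\] and \[\begin{aligned}X(\alpha,\beta)={}&2(2+\beta-2\alpha)\bigl(1+e^2-2e(2\alpha+\beta-1)\bigr)\Bigl((-2\alpha+2+\beta)-\sqrt{(-2\alpha+2+\beta)^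2-4(e-1)(2\alpha-1+\beta-e)}\Bigr)\\&+4(2\alpha+\beta-1-e)(e^2-1)(2\alpha+\beta-2).\end{aligned}\]
   Context: $\mathbb{D}=\{z\in\mathbb{C}:|z|<1\}$. $\mathcal{A}$ is the class of analytic functions $f$ on $\mathbb{D}$ with $f(0)=0$, $f'(0)=1$. For $0\leqslant\alpha<1$, $\mathcal{ST}(\alpha)$ (starlike functions of order $\alpha$) is the class of $f\in\mathcal{A}$ with $\operatorname{Re}(zf'(z)/f(z))>\alpha$ for all $z\in\mathbb{D}$ (the quotient being given the value $1$ at $z=0$). For analytic $g,h$ on $\mathbb{D}$, $g\prec h$ (subordination) means $g=h\circ w$ for some analytic $w:\mathbb{D}\to\mathbb{D}$ with $w(0)=0$. $\mathcal{S}^{*}_{e}$ is the class of $f\in\mathcal{A}$ with $zf'(z)/f(z)\prec e^{z}$ (equivalently $|\log(zf'(z)/f(z))|<1$ on $\mathbb{D}$). Since $Q$ is non-vanishing in $\mathbb{D}$ and $Q(0)=1$, $(Q(z))^{\beta/n}$ denotes the analytic branch on $\mathbb{D}$ equal to $1$ at $z=0$, so $F\in\mathcal{A}$. Here $e$ is Euler's number. *)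

theory Defs
  imports "HOL-Complex_Analysis.Complex_Analysis" "HOL-Computational_Algebra.Polynomial"
begin

(* The open unit disc is ball 0 1.  Functions on it are represented by total functions
   complex => complex; their values outside ball 0 1 are never constrained. *)

definition class_A :: "(complex \<Rightarrow> complex) set" where
  "class_A = {f. f holomorphic_on ball 0 1 \<and> f 0 = 0 \<and> deriv f 0 = 1}"

(* z f'(z) / f(z) with the value 1 at the origin.  If f vanishes at some z \<noteq> 0 the
   quotient is 0 by the convention x / 0 = 0; both class_ST and exp_starlike below exclude
   the value 0, so membership forces f to be zero-free on the punctured disc. *)
definition zlogderiv :: "(complex \<Rightarrow> complex) \<Rightarrow> complex \<Rightarrow> complex" where
  "zlogderiv f z = (if z = 0 then 1 else z * deriv f z / f z)"

definition class_ST :: "real \<Rightarrow> (complex \<Rightarrow> complex) set" where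
  "class_ST \<alpha> = {f \<in> class_A. \<forall>z\<in>ball 0 1. Re (zlogderiv f z) > \<alpha>}"

definition subordinate :: "(complex \<Rightarrow> complex) \<Rightarrow> (complex \<Rightarrow> complex) \<Rightarrow> bool" where
  "subordinate g h \<longleftrightarrow>
     g holomorphic_on ball 0 1 \<and> h holomorphic_on ball 0 1 \<and>
     (\<exists>w. w holomorphic_on ball 0 1 \<and> w ` ball 0 1 \<subseteq> ball 0 1 \<and> w 0 = 0 \<and>
          (\<forall>z\<in>ball 0 1. g z = h (w z)))"

definition exp_starlike :: "(complex \<Rightarrow> complex) set" where
  "exp_starlike = {f \<in> class_A. subordinate (zlogderiv f) exp}"

(* g is the analytic branch of q powr c on the unit disc with g 0 = 1; it exists and is
   unique when q is holomorphic and zero-free on the disc with q 0 = 1 (lemmas below). *)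
definition is_power_branch ::
    "(complex \<Rightarrow> complex) \<Rightarrow> real \<Rightarrow> (complex \<Rightarrow> complex) \<Rightarrow> bool" where
  "is_power_branch q c g \<longleftrightarrow>
     (\<exists>L. L holomorphic_on ball 0 1 \<and> L 0 = 0 \<and>
          (\<forall>z\<in>ball 0 1. exp (L z) = q z \<and> g z = exp (of_real c * L z)))"

lemma is_power_branch_exists:
  assumes "q holomorphic_on ball 0 1" "\<And>z. z \<in> ball 0 1 \<Longrightarrow> q z \<noteq> 0" "q 0 = 1"
  shows "\<exists>g. is_power_branch q c g"
proof -
  obtain h where h: "h holomorphic_on ball 0 1" "\<And>z. z \<in> ball 0 1 \<Longrightarrow> q z = exp (h z)"
    using contractible_imp_holomorphic_log[OF assms(1) convex_imp_contractible[OF convex_ball] assms(2)]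
    by blast
  have "exp (h 0) = 1"
    using h(2)[of 0] assms(3) by simp
  then have "is_power_branch q c (\<lambda>z. exp (of_real c * (h z - h 0)))"
    unfolding is_power_branch_def
    by (intro exI[of _ "\<lambda>z. h z - h 0"]) (auto intro!: holomorphic_intros h(1) simp: exp_diff h(2))
  then show ?thesis by blast
qed

lemma is_power_branch_unique:
  assumes "is_power_branch q c g1" "is_power_branch q c g2" "z \<in> ball 0 1"
  shows "g1 z = g2 z"
proof -
  obtain L1 where L1: "L1 holomorphic_on ball 0 1" "L1 0 = 0"
      "\<And>z. z \<in> ball 0 1 \<Longrightarrow> exp (L1 z) = q z \<and> g1 z = exp (of_real c * L1 z)"
    using assms(1) unfolding is_power_branch_def by blast
  obtain L2 where L2: "L2 holomorphic_on ball 0 1" "L2 0 = 0"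
      "\<And>z. z \<in> ball 0 1 \<Longrightarrow> exp (L2 z) = q z \<and> g2 z = exp (of_real c * L2 z)"
    using assms(2) unfolding is_power_branch_def by blast
  have der: "((\<lambda>z. L1 z - L2 z) has_field_derivative 0) (at x)" if x: "x \<in> ball 0 1" for x
  proof -
    have d1: "(L1 has_field_derivative deriv L1 x) (at x)"
      using L1(1) x by (simp add: holomorphic_derivI)
    have d2: "(L2 has_field_derivative deriv L2 x) (at x)"
      using L2(1) x by (simp add: holomorphic_derivI)
    have e1: "((\<lambda>z. exp (L1 z)) has_field_derivative exp (L1 x) * deriv L1 x) (at x)"
      using d1 by (auto intro!: derivative_eq_intros)
    have e2: "((\<lambda>z. exp (L2 z)) has_field_derivative exp (L2 x) * deriv L2 x) (at x)"
      using d2 by (auto intro!: derivative_eq_intros)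
    have "((\<lambda>z. exp (L1 z)) has_field_derivative exp (L2 x) * deriv L2 x) (at x)"
      using e2 has_field_derivative_transform_within_open[OF e2 open_ball x, of "\<lambda>z. exp (L1 z)"]
        L1(3) L2(3) by simp
    then have "exp (L1 x) * deriv L1 x = exp (L2 x) * deriv L2 x"
      using e1 DERIV_unique by blast
    moreover have "exp (L1 x) = exp (L2 x)"
      using L1(3)[OF x] L2(3)[OF x] by simp
    ultimately have "deriv L1 x = deriv L2 x" by simp
    then show ?thesis using DERIV_diff[OF d1 d2] by simp
  qed
  obtain c0 where "\<And>x. x \<in> ball 0 1 \<Longrightarrow> L1 x - L2 x = c0"
    using has_field_derivative_zero_constant[OF convex_ball, of 0 1 "\<lambda>z. L1 z - L2 z"]
      der has_field_derivative_at_within by metis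
  from this[of z] this[of 0] have "L1 z - L2 z = L1 0 - L2 0"
    using assms(3) by simp
  then have "L1 z = L2 z" using L1(2) L2(2) by simp
  then show ?thesis using L1(3)[OF assms(3)] L2(3)[OF assms(3)] by simp
qed

definition family_F :: "real \<Rightarrow> real \<Rightarrow> nat \<Rightarrow> (complex \<Rightarrow> complex) set" where
  "family_F \<alpha> \<beta> n =
     {F. \<exists>f\<in>class_ST \<alpha>. \<exists>Q :: complex poly. \<exists>g.
           degree Q = n \<and> poly Q 0 = 1 \<and> (\<forall>z. poly Q z = 0 \<longrightarrow> z \<notin> ball 0 1) \<and>
           is_power_branch (poly Q) (\<beta> / real n) g \<and>
           (\<forall>z\<in>ball 0 1. F z = f z * g z)}"

definition exp_starlike_up_to :: "(complex \<Rightarrow> complex) set \<Rightarrow> real \<Rightarrow> bool" where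
  "exp_starlike_up_to \<F> R \<longleftrightarrow>
     (\<forall>F\<in>\<F>. \<forall>r. 0 < r \<and> r < R \<longrightarrow>
        (\<lambda>z. F (of_real r * z) / of_real r) \<in> exp_starlike)"

(* A relation rather than a GREATEST-style choice, so that the existence of the largest
   R is part of what it asserts. *)
definition is_exp_starlike_radius :: "(complex \<Rightarrow> complex) set \<Rightarrow> real \<Rightarrow> bool" where
  "is_exp_starlike_radius \<F> R \<longleftrightarrow>
     R \<in> {0<..<1} \<and> exp_starlike_up_to \<F> R \<and>
     (\<forall>R'\<in>{0<..<1}. exp_starlike_up_to \<F> R' \<longrightarrow> R' \<le> R)"

definition \<sigma>0 :: "real \<Rightarrow> real \<Rightarrow> real" where
  "\<sigma>0 \<alpha> \<beta> = (let e = exp 1 in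
     2 * (e - 1) /
     (e * (2 - 2 * \<alpha> + \<beta>) +
      sqrt ((e * (2 - 2 * \<alpha> + \<beta>))\<^sup>2 - 4 * (e - 1) * (1 - e * (2 * \<alpha> - 1 + \<beta>)))))"

definition \<sigma>0_tilde :: "real \<Rightarrow> real \<Rightarrow> real" where
  "\<sigma>0_tilde \<alpha> \<beta> = (let e = exp 1 in
     2 * (e - 1) /
     ((2 - 2 * \<alpha> + \<beta>) +
      sqrt ((2 - 2 * \<alpha> + \<beta>)\<^sup>2 - 4 * (e - 1) * (2 * \<alpha> - 1 + \<beta> - e))))"

definition X_fun :: "real \<Rightarrow> real \<Rightarrow> real" where
  "X_fun \<alpha> \<beta> = (let e = exp 1 in
     2 * (2 + \<beta> - 2 * \<alpha>) * (1 + e\<^sup>2 - 2 * e * (2 * \<alpha> + \<beta> - 1)) *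
       ((- 2 * \<alpha> + 2 + \<beta>) -
        sqrt ((- 2 * \<alpha> + 2 + \<beta>)\<^sup>2 - 4 * (e - 1) * (2 * \<alpha> - 1 + \<beta> - e)))
     + 4 * (2 * \<alpha> + \<beta> - 1 - e) * (e\<^sup>2 - 1) * (2 * \<alpha> + \<beta> - 2))"

end

theory Submission
  imports Defs "HOL-Computational_Algebra.Fundamental_Theorem_Algebra"
begin

text \<open>
  If \<open>|z| = t < 1\<close>, Schwarz' lemma for the starlike factor and the factorisation of \<open>Q\<close> place
  \<open>z F'(z) / F(z)\<close> in the closed disc with centre \<open>a(t) = (1 - (2\<alpha> - 1 + \<beta>) t^2) / (1 - t^2)\<close>
  and radius \<open>\<rho>(t) = (2 - 2\<alpha> + \<beta>) t / (1 - t^2)\<close>. The disc with diameter \<open>[1/e, e]\<close>, centred at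
  \<open>cosh 1\<close> with radius \<open>sinh 1\<close>, lies in the image of the unit disc under \<open>exp\<close>, so
  \<open>1/e < a - \<rho>\<close> and \<open>a + \<rho> < e\<close> suffice. These two inequalities first fail at \<open>\<sigma>0\<close> and at
  \<open>\<sigma>0_tilde\<close> respectively, and the sign of \<open>X\<close> decides which of the two numbers is smaller.
  For \<open>F(z) = z (1 - z)^(-2(1 - \<alpha>)) (1 + z)^\<beta>\<close> the quotient \<open>z F'(z) / F(z)\<close> equals \<open>1/e\<close> at
  \<open>-\<sigma>0\<close> and \<open>e\<close> at \<open>\<sigma>0_tilde\<close>, so neither bound can be improved.
\<close>

section \<open>Two elementary tools: a root of a quadratic and the Moebius image of a disc\<close>

text \<open>The quadratic is positive at 0 and negative at 1, so it changes sign exactly once on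
  [0, 1]. The rationalised formula for \<open>s\<close> selects that root and stays valid when
  \<open>A = 0\<close>.\<close>

lemma quadratic_root_sign:
  fixes A B C :: real
  assumes C: "0 < C" and neg: "A - B + C < 0"
  defines "s \<equiv> 2 * C / (B + sqrt (B\<^sup>2 - 4 * C * A))"
  shows "0 < s" "s < 1" "A * s\<^sup>2 - B * s + C = 0"
    "\<And>t. 0 \<le> t \<Longrightarrow> t \<le> 1 \<Longrightarrow> 0 < A * t\<^sup>2 - B * t + C \<longleftrightarrow> t < s"
proof -
  define S where "S = sqrt (B\<^sup>2 - 4 * C * A)"
  \<comment> \<open>Negativity at 1 makes the discriminant exceed
    \<open>(2 * C - B)\<^sup>2\<close>, hence \<open>2 * C < B + S\<close>, which is what places
    \<open>s\<close> between 0 and 1.\<close>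
  have "C * A < C * (B - C)" using C neg by (intro mult_strict_left_mono) auto
  then have disc: "(2 * C - B)\<^sup>2 < B\<^sup>2 - 4 * C * A"
    by (simp add: power2_eq_square algebra_simps)
  then have nn: "0 \<le> B\<^sup>2 - 4 * C * A" by (smt (verit) zero_le_power2)
  have S2: "S\<^sup>2 = B\<^sup>2 - 4 * C * A" using nn by (simp add: S_def)
  have "\<bar>2 * C - B\<bar> < S" unfolding S_def using disc real_less_rsqrt by (metis power2_abs)
  then have BS: "2 * C < B + S" by linarith
  have s: "s = 2 * C / (B + S)" by (simp add: s_def S_def)
  show s0: "0 < s" using BS C by (simp add: s)
  show s1: "s < 1" using BS C by (simp add: s)
  have sBS: "s * (B + S) = 2 * C" using BS C by (simp add: s)
  have "(A * s\<^sup>2 - B * s + C) * (B + S)\<^sup>2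
      = A * (s * (B + S))\<^sup>2 - B * (s * (B + S)) * (B + S) + C * (B + S)\<^sup>2"
    by (simp add: power2_eq_square algebra_simps)
  also have "\<dots> = C * (4 * C * A - B\<^sup>2 + S\<^sup>2)"
    unfolding sBS by (simp add: power2_eq_square algebra_simps)
  also have "\<dots> = 0" by (simp add: S2)
  finally show root: "A * s\<^sup>2 - B * s + C = 0" using BS C by auto
  \<comment> \<open>For \<open>A \<noteq> 0\<close> the other root is \<open>C / (A * s)\<close> by
    Vieta; this form of the factorisation avoids dividing by \<open>A\<close>.\<close>
  have fact: "s * (A * t\<^sup>2 - B * t + C) = (s - t) * (C - A * s * t)" for t
  proof -
    have "(s - t) * (C - A * s * t) = s * (A * t\<^sup>2 - B * t + C) - t * (A * s\<^sup>2 - B * s + C)"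
      by (simp add: power2_eq_square algebra_simps)
    then show ?thesis by (simp add: root)
  qed
  have "(s - 1) * (C - A * s) < 0"
    using fact[of 1] neg s0 by (metis mult.right_neutral mult_pos_neg power_one)
  then have end_pos: "0 < C - A * s" using s1 by (simp add: mult_less_0_iff)
  fix t :: real assume t: "0 \<le> t" "t \<le> 1"
  \<comment> \<open>The second factor is affine in \<open>t\<close>, positive at 0 because of
    \<open>C\<close> and at 1 by \<open>end_pos\<close>.\<close>
  have pos: "0 < C - A * s * t"
  proof (cases "A * s \<le> 0")
    case True
    then show ?thesis using t C by (smt (verit) mult_nonneg_nonpos2)
  next
    case False
    then have "A * s * t \<le> A * s" using t by (simp add: mult_left_le)
    then show ?thesis using end_pos by linarith
  qed
  show "0 < A * t\<^sup>2 - B * t + C \<longleftrightarrow> t < s"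
    using fact[of t] pos s0 by (metis diff_gt_0_iff_gt zero_less_mult_pos zero_less_mult_pos2 mult_pos_pos)
qed

text \<open>The map u/(1 - u) sends the disc of radius \<open>t\<close> about 0 to the disc with
  real diameter from -t/(1 + t) to t/(1 - t); the centre and radius here are those of that
  image.\<close>

lemma norm_mobius_diff_le:
  fixes u :: complex
  assumes "norm u \<le> t" "t < 1"
  shows "norm (u / (1 - u) - of_real (t\<^sup>2 / (1 - t\<^sup>2))) \<le> t / (1 - t\<^sup>2)"
proof -
  have t0: "0 \<le> t" using assms(1) norm_ge_zero order_trans by blast
  have t2: "0 < 1 - t\<^sup>2" using t0 assms(2) by (simp add: power_less_one_iff abs_square_less_1)
  have u1: "1 - u \<noteq> 0" using assms by auto
  have nu: "(Re u)\<^sup>2 + (Im u)\<^sup>2 \<le> t\<^sup>2"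
    using power_mono[OF assms(1), of 2] by (simp add: cmod_power2)
  \<comment> \<open>Clearing denominators reduces the claim to this inequality, which describes the
    disc \<open>norm u \<le> t\<close> as an Apollonius disc.\<close>
  have "(norm (u - of_real (t\<^sup>2)))\<^sup>2 \<le> (t * norm (1 - u))\<^sup>2"
  proof -
    have "(t * norm (1 - u))\<^sup>2 - (norm (u - of_real (t\<^sup>2)))\<^sup>2
        = (1 - t\<^sup>2) * (t\<^sup>2 - ((Re u)\<^sup>2 + (Im u)\<^sup>2))"
      unfolding power_mult_distrib cmod_power2 by (simp add: power2_eq_square algebra_simps)
    also have "\<dots> \<ge> 0" using t2 nu by simp
    finally show ?thesis by simp
  qed
  then have le: "norm (u - of_real (t\<^sup>2)) \<le> t * norm (1 - u)"
    by (rule power2_le_imp_le) (use t0 in simp)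
  have c: "(1 - complex_of_real (t\<^sup>2)) \<noteq> 0"
    using t2 by (metis diff_gt_0_iff_gt eq_iff_diff_eq_0 less_irrefl of_real_eq_1_iff)
  have "u / (1 - u) - of_real (t\<^sup>2 / (1 - t\<^sup>2)) = (u - of_real (t\<^sup>2)) / ((1 - u) * of_real (1 - t\<^sup>2))"
    using u1 c by (simp add: field_simps)
  then have "norm (u / (1 - u) - of_real (t\<^sup>2 / (1 - t\<^sup>2)))
      = norm (u - of_real (t\<^sup>2)) / (norm (1 - u) * (1 - t\<^sup>2))"
    using t2 by (simp only: norm_divide norm_mult norm_of_real abs_of_pos)
  also have "\<dots> \<le> (t * norm (1 - u)) / (norm (1 - u) * (1 - t\<^sup>2))"
    using le t2 by (intro divide_right_mono) auto
  also have "\<dots> = t / (1 - t\<^sup>2)" using u1 by simp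
  finally show ?thesis .
qed

section \<open>A disc inside the image of the unit disc under the exponential function\<close>

text \<open>Since \<open>sinh x \<le> x * cosh x\<close>, the function
  \<open>cosh x * exp (- x\<^sup>2 / 2)\<close> is nonincreasing for \<open>x \<ge> 0\<close>; its
  values at \<open>\<bar>u\<bar>\<close> and at 1 are compared. Equality holds at u = 1 and u = -1,
  the logarithms of the ends of the diameter [1/e, e].\<close>

lemma cosh_ge_gaussian:
  fixes u :: real
  assumes "\<bar>u\<bar> \<le> 1"
  shows "cosh 1 * exp ((u\<^sup>2 - 1) / 2) \<le> cosh u"
proof -
  have sinh_le: "sinh x \<le> x * cosh x" if "0 \<le> x" for x :: real
  proof -
    have "(\<lambda>x. x * cosh x - sinh x) 0 \<le> (\<lambda>x. x * cosh x - sinh x) x"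
    proof (rule DERIV_nonneg_imp_nondecreasing[OF that])
      fix y :: real assume "0 \<le> y" "y \<le> x"
      then show "\<exists>d. ((\<lambda>x. x * cosh x - sinh x) has_real_derivative d) (at y) \<and> 0 \<le> d"
        by (intro exI[of _ "y * sinh y"]) (auto intro!: derivative_eq_intros)
    qed
    then show ?thesis by simp
  qed
  have "(\<lambda>x. cosh x * exp (- x\<^sup>2 / 2)) \<bar>u\<bar> \<ge> (\<lambda>x. cosh x * exp (- x\<^sup>2 / 2)) 1"
  proof (rule DERIV_nonpos_imp_nonincreasing[OF assms])
    fix y :: real assume y: "\<bar>u\<bar> \<le> y" "y \<le> 1"
    have "((\<lambda>x. cosh x * exp (- x\<^sup>2 / 2)) has_real_derivative
        (sinh y - y * cosh y) * exp (- y\<^sup>2 / 2)) (at y)"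
      by (auto intro!: derivative_eq_intros simp: algebra_simps)
    moreover have "(sinh y - y * cosh y) * exp (- y\<^sup>2 / 2) \<le> 0"
      using sinh_le[of y] y by (intro mult_nonpos_nonneg) auto
    ultimately show "\<exists>d. ((\<lambda>x. cosh x * exp (- x\<^sup>2 / 2)) has_real_derivative d) (at y) \<and> d \<le> 0"
      by blast
  qed
  then have "cosh 1 * exp (- 1 / 2) * exp (u\<^sup>2 / 2) \<le> cosh u * exp (- u\<^sup>2 / 2) * exp (u\<^sup>2 / 2)"
    by simp
  also have "\<dots> = cosh u" by (simp add: exp_minus)
  finally show ?thesis by (simp add: exp_add[symmetric] mult.assoc diff_divide_distrib)
qed

text \<open>The function \<open>cos x * exp (x\<^sup>2 / 2)\<close> equals 1 at 0 and its derivative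
  has the sign of \<open>x * cos x - sin x\<close>, which is nonpositive on [0, pi].\<close>

lemma cos_le_gaussian:
  fixes v :: real
  assumes "\<bar>v\<bar> \<le> pi / 2"
  shows "cos v \<le> exp (- v\<^sup>2 / 2)"
proof -
  have le_sin: "x * cos x \<le> sin x" if x: "0 \<le> x" "x \<le> pi" for x :: real
  proof -
    have "(\<lambda>x. sin x - x * cos x) 0 \<le> (\<lambda>x. sin x - x * cos x) x"
    proof (rule DERIV_nonneg_imp_nondecreasing[OF x(1)])
      fix y :: real assume "0 \<le> y" "y \<le> x"
      then show "\<exists>d. ((\<lambda>x. sin x - x * cos x) has_real_derivative d) (at y) \<and> 0 \<le> d"
        using x sin_ge_zero
        by (intro exI[of _ "y * sin y"]) (auto intro!: derivative_eq_intros)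
    qed
    then show ?thesis by simp
  qed
  have "(\<lambda>x. cos x * exp (x\<^sup>2 / 2)) 0 \<ge> (\<lambda>x. cos x * exp (x\<^sup>2 / 2)) \<bar>v\<bar>"
  proof (rule DERIV_nonpos_imp_nonincreasing[OF abs_ge_zero])
    fix y :: real assume y: "0 \<le> y" "y \<le> \<bar>v\<bar>"
    have "((\<lambda>x. cos x * exp (x\<^sup>2 / 2)) has_real_derivative
        (y * cos y - sin y) * exp (y\<^sup>2 / 2)) (at y)"
      by (auto intro!: derivative_eq_intros simp: algebra_simps)
    moreover have "(y * cos y - sin y) * exp (y\<^sup>2 / 2) \<le> 0"
      using le_sin[of y] y assms by (intro mult_nonpos_nonneg) auto
    ultimately show "\<exists>d. ((\<lambda>x. cos x * exp (x\<^sup>2 / 2)) has_real_derivative d) (at y) \<and> d \<le> 0"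
      by blast
  qed
  then have "cos v * exp (v\<^sup>2 / 2) \<le> 1" by simp
  then have "cos v * exp (v\<^sup>2 / 2) * exp (- v\<^sup>2 / 2) \<le> exp (- v\<^sup>2 / 2)" by simp
  then show ?thesis by (simp add: mult.assoc exp_add[symmetric])
qed

text \<open>With \<open>Ln w = u + \<i> v\<close> the hypothesis reads \<open>cosh u < cos v * cosh 1\<close>; the two Gaussian
  bounds contradict this when \<open>u^2 + v^2 \<ge> 1\<close>.\<close>
lemma norm_Ln_less_one:
  fixes w :: complex
  assumes w: "norm (w - of_real (cosh 1)) < sinh 1"
  shows "0 < Re w" "norm (Ln w) < 1"
proof -
  \<comment> \<open>The leftmost point of the disc is 1/e > 0, so the disc avoids the branch cut of
    \<open>Ln\<close>.\<close>
  have "cosh 1 - sinh 1 = (exp (- 1) :: real)" by (rule cosh_minus_sinh)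
  then have sc: "sinh 1 < (cosh 1 :: real)" using exp_gt_zero[of "- 1 :: real"] by linarith
  have "cosh 1 - Re w \<le> norm (w - of_real (cosh 1))"
    using abs_Re_le_cmod[of "w - of_real (cosh 1)"] by simp
  then show Re: "0 < Re w" using w sc by linarith
  then have w0: "w \<noteq> 0" by auto
  define u v where "u = Re (Ln w)" and "v = Im (Ln w)"
  have wexp: "w = exp (Ln w)" using w0 by simp
  have Rw: "Re w = exp u * cos v" and Iw: "Im w = exp u * sin v"
    by (subst wexp, simp add: Re_exp Im_exp u_def v_def)+
  have v: "\<bar>v\<bar> < pi / 2" unfolding v_def using Re Re_Ln_pos_lt w0 by blast
  \<comment> \<open>Because |w| = exp u and cosh^2 - sinh^2 = 1, the disc condition becomes |w|^2 +
    1 < 2 * cosh 1 * Re w; division by 2 * exp u then gives \<open>key\<close>.\<close>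
  have "(Re w - cosh 1)\<^sup>2 + (Im w)\<^sup>2 < (sinh 1)\<^sup>2"
    using power_strict_mono[OF w norm_ge_zero, of 2] by (simp add: cmod_power2)
  moreover have "(Re w)\<^sup>2 + (Im w)\<^sup>2 = (exp u)\<^sup>2"
    unfolding Rw Iw power_mult_distrib by (metis distrib_left mult.right_neutral sin_cos_squared_add2)
  moreover have "(cosh 1)\<^sup>2 - (sinh 1)\<^sup>2 = (1::real)" by (simp add: hyperbolic_pythagoras)
  ultimately have "(exp u)\<^sup>2 + 1 < 2 * (exp u * cos v) * cosh 1"
    unfolding Rw[symmetric] by (simp add: power2_eq_square algebra_simps)
  moreover have "(exp u)\<^sup>2 + 1 = 2 * cosh u * exp u"
    by (simp add: cosh_def power2_eq_square algebra_simps flip: exp_add)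
  ultimately have "exp u * cosh u < exp u * (cos v * cosh 1)" by (simp add: algebra_simps)
  then have key: "cosh u < cos v * cosh 1" by simp
  have "u\<^sup>2 + v\<^sup>2 < 1"
  proof (rule ccontr)
    assume "\<not> u\<^sup>2 + v\<^sup>2 < 1"
    then have uv: "- v\<^sup>2 / 2 \<le> (u\<^sup>2 - 1) / 2" by simp
    \<comment> \<open>Bounding the cosine by 1 in \<open>key\<close> confines \<open>u\<close> to
      [-1, 1], the range of \<open>cosh_ge_gaussian\<close>.\<close>
    have "cosh u < cosh 1"
      using key mult_right_mono[OF cos_le_one[of v] cosh_real_nonneg[of 1]] by linarith
    then have "\<bar>u\<bar> \<le> 1"
      using cosh_real_nonneg_le_iff[of 1 "\<bar>u\<bar>"] by (smt (verit) cosh_real_abs)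
    then have "cosh 1 * exp ((u\<^sup>2 - 1) / 2) \<le> cosh u" by (rule cosh_ge_gaussian)
    moreover have "cos v \<le> exp ((u\<^sup>2 - 1) / 2)"
      using cos_le_gaussian[of v] v uv by (smt (verit) exp_le_cancel_iff)
    then have "cos v * cosh 1 \<le> exp ((u\<^sup>2 - 1) / 2) * cosh 1"
      by (intro mult_right_mono) auto
    ultimately show False using key by (simp only: mult.commute[of "cosh 1"])
  qed
  then show "norm (Ln w) < 1" by (simp add: cmod_def u_def v_def)
qed

section \<open>Discs containing the logarithmic derivatives of the two factors\<close>

text \<open>The singularity at 0 is removable: writing f(z) = z h(z) with \<open>h\<close> zero-free
  turns the quotient into 1 + z h'(z)/h(z), whose value at 0 is the prescribed 1.\<close>

lemma zlogderiv_holomorphic: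
  assumes f: "f \<in> class_A" and nz: "\<And>z. z \<in> ball 0 1 \<Longrightarrow> z \<noteq> 0 \<Longrightarrow> f z \<noteq> 0"
  shows "zlogderiv f holomorphic_on ball 0 1"
proof -
  have fh: "f holomorphic_on ball 0 1" "f 0 = 0" "deriv f 0 = 1"
    using f by (auto simp: class_A_def)
  obtain h where h: "h holomorphic_on ball 0 1" "\<And>z. norm z < 1 \<Longrightarrow> f z = z * h z"
      "deriv f 0 = h 0"
    using Schwarz3[OF fh(1,2)] by blast
  have hnz: "h z \<noteq> 0" if "z \<in> ball 0 1" for z
    using that nz[of z] h(2)[of z] h(3) fh(3) by (cases "z = 0") auto
  have "(\<lambda>z. 1 + z * deriv h z / h z) holomorphic_on ball 0 1"
    using hnz h(1) by (intro holomorphic_intros) auto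
  moreover have "1 + z * deriv h z / h z = zlogderiv f z" if z: "z \<in> ball 0 1" for z
  proof (cases "z = 0")
    case False
    have "(h has_field_derivative deriv h z) (at z)"
      using h(1) z by (simp add: holomorphic_derivI)
    then have "((\<lambda>z. z * h z) has_field_derivative h z + z * deriv h z) (at z)"
      by (auto intro!: derivative_eq_intros)
    then have "(f has_field_derivative h z + z * deriv h z) (at z)"
      by (rule has_field_derivative_transform_within_open[OF _ open_ball z]) (use h(2) in auto)
    then have "deriv f z = h z + z * deriv h z" by (rule DERIV_imp_deriv)
    then show ?thesis
      using False hnz[OF z] h(2)[of z] z by (simp add: zlogderiv_def field_simps)
  qed (simp add: zlogderiv_def)
  ultimately show ?thesis by (rule holomorphic_transform)
qed

lemma class_ST_nonzero:
  assumes "f \<in> class_ST \<alpha>" "0 \<le> \<alpha>" "z \<in> ball 0 1" "z \<noteq> 0"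
  shows "f z \<noteq> 0"
proof
  assume "f z = 0"
  then have "zlogderiv f z = 0" using assms(4) by (simp add: zlogderiv_def)
  then show False using assms(1-3) unfolding class_ST_def by fastforce
qed

text \<open>A Cayley transform makes the quotient a self-map \<open>\<phi>\<close> of the unit disc
  fixing 0, so Schwarz' lemma gives \<open>norm (\<phi> z) \<le> norm z\<close>. Solving back, p = 1
  + 2(1 - \<alpha>) \<phi>/(1 - \<phi>), and \<open>norm_mobius_diff_le\<close> applies.\<close>

lemma class_ST_disc:
  assumes f: "f \<in> class_ST \<alpha>" and \<alpha>: "0 \<le> \<alpha>" "\<alpha> < 1" and z: "z \<in> ball 0 1"
  shows "norm (zlogderiv f z - 1 - of_real (2 * (1 - \<alpha>) * ((norm z)\<^sup>2 / (1 - (norm z)\<^sup>2))))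
    \<le> 2 * (1 - \<alpha>) * (norm z / (1 - (norm z)\<^sup>2))"
proof -
  define p where "p = zlogderiv f"
  \<comment> \<open>The pole 2\<alpha> - 1 is the mirror image of 1 in the line Re w = \<alpha>, so
    the half-plane Re w > \<alpha> goes to the unit disc and 1 goes to 0.\<close>
  define \<phi> where "\<phi> = (\<lambda>z. (p z - 1) / (p z + 1 - of_real (2 * \<alpha>)))"
  have Re: "\<alpha> < Re (p y)" if "y \<in> ball 0 1" for y
    using f that by (auto simp: class_ST_def p_def)
  have ph: "p holomorphic_on ball 0 1"
    unfolding p_def using f class_ST_nonzero[OF f \<alpha>(1)]
    by (intro zlogderiv_holomorphic) (auto simp: class_ST_def)
  have den: "p y + 1 - of_real (2 * \<alpha>) \<noteq> 0" if "y \<in> ball 0 1" for y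
  proof
    assume "p y + 1 - of_real (2 * \<alpha>) = 0"
    then have "Re (p y) + 1 - 2 * \<alpha> = 0" by (simp add: complex_eq_iff)
    then show False using Re[OF that] \<alpha> by simp
  qed
  have "\<phi> holomorphic_on ball 0 1"
    unfolding \<phi>_def using den by (intro holomorphic_intros ph) auto
  moreover have "\<phi> 0 = 0" by (simp add: \<phi>_def p_def zlogderiv_def)
  moreover have "norm (\<phi> y) < 1" if "norm y < 1" for y
  proof -
    have y: "y \<in> ball 0 1" using that by simp
    have "(norm (p y + 1 - of_real (2 * \<alpha>)))\<^sup>2 - (norm (p y - 1))\<^sup>2
        = 4 * (1 - \<alpha>) * (Re (p y) - \<alpha>)"
      unfolding cmod_power2 by (simp add: power2_eq_square algebra_simps)
    also have "\<dots> > 0" using Re[OF y] \<alpha> by simp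
    finally have "norm (p y - 1) < norm (p y + 1 - of_real (2 * \<alpha>))"
      using power2_less_imp_less[of "norm (p y - 1)"] by simp
    then show ?thesis
      unfolding \<phi>_def norm_divide using den[OF y] by (simp add: divide_less_eq)
  qed
  ultimately have \<phi>: "norm (\<phi> z) \<le> norm z"
    using Schwarz_Lemma(1)[of \<phi> z] z by auto
  have "(1 - \<phi> z) = of_real (2 * (1 - \<alpha>)) / (p z + 1 - of_real (2 * \<alpha>))"
    unfolding \<phi>_def using den[OF z] by (simp add: field_simps)
  then have "\<phi> z / (1 - \<phi> z) = (p z - 1) / of_real (2 * (1 - \<alpha>))"
    unfolding \<phi>_def using den[OF z] \<alpha> by simp
  then have "p z - 1 = of_real (2 * (1 - \<alpha>)) * (\<phi> z / (1 - \<phi> z))"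
    using \<alpha> by (simp add: field_simps)
  then have eq: "p z - 1 - of_real (2 * (1 - \<alpha>) * ((norm z)\<^sup>2 / (1 - (norm z)\<^sup>2)))
    = of_real (2 * (1 - \<alpha>)) * (\<phi> z / (1 - \<phi> z) - of_real ((norm z)\<^sup>2 / (1 - (norm z)\<^sup>2)))"
    by (simp only: of_real_mult right_diff_distrib)
  show ?thesis
    unfolding p_def[symmetric] eq norm_mult norm_of_real
    using \<alpha> z by (intro mult_mono norm_mobius_diff_le[OF \<phi>]) auto
qed

text \<open>The logarithmic derivative is a sum over the roots. A root c contributes z/(z - c) =
  -u/(1 - u) with u = z/c, and |c| \<ge> 1 gives |u| \<le> |z|; so each root adds one reflected
  Moebius disc, and the induction splits off one root at a time.\<close>

lemma poly_logderiv_disc: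
  fixes Q :: "complex poly"
  assumes "\<And>x. poly Q x = 0 \<Longrightarrow> x \<notin> ball 0 1" and z: "z \<in> ball 0 1"
  shows "norm (z * poly (pderiv Q) z / poly Q z
      + of_real (real (degree Q) * ((norm z)\<^sup>2 / (1 - (norm z)\<^sup>2))))
    \<le> real (degree Q) * (norm z / (1 - (norm z)\<^sup>2))"
  using assms(1)
proof (induction "degree Q" arbitrary: Q)
  case 0
  then obtain c where "Q = [:c:]" by (metis degree_eq_zeroE)
  then show ?case by (simp add: pderiv_pCons)
next
  case (Suc n)
  define q where "q = (norm z)\<^sup>2 / (1 - (norm z)\<^sup>2)"
  define d where "d = norm z / (1 - (norm z)\<^sup>2)"
  obtain c where c: "poly Q c = 0"
    using alg_closed_imp_poly_has_root[of Q] Suc(2) by auto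
  then obtain P where Q: "Q = [:- c, 1:] * P" by (meson dvdE poly_eq_0_iff_dvd)
  have P0: "P \<noteq> 0" using Suc(2) Q by auto
  have dQ: "degree Q = Suc (degree P)" unfolding Q using P0 by (subst degree_mult_eq) auto
  have nP: "\<And>x. poly P x = 0 \<Longrightarrow> x \<notin> ball 0 1" using Suc(3) Q by auto
  have IH: "norm (z * poly (pderiv P) z / poly P z + of_real (real (degree P) * q))
      \<le> real (degree P) * d"
    unfolding q_def d_def using Suc(1)[of P] nP dQ Suc(2) by simp
  have Pz: "poly P z \<noteq> 0" using nP z by blast
  have c1: "1 \<le> norm c" using Suc(3)[OF c] by simp
  then have c0: "c \<noteq> 0" by auto
  have zc: "z \<noteq> c" using c1 z by auto
  have "norm (z / c) \<le> norm z"
    using c1 mult_right_mono[OF c1 norm_ge_zero[of z]] c0 by (simp add: norm_divide field_simps)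
  then have B: "norm (z / c / (1 - z / c) - of_real q) \<le> d"
    unfolding q_def d_def using z by (intro norm_mobius_diff_le) auto
  have u: "z / c / (1 - z / c) = - (z / (z - c))"
    using c0 zc by (simp add: field_simps)
  have "z * poly (pderiv Q) z / poly Q z = z / (z - c) + z * poly (pderiv P) z / poly P z"
    unfolding Q pderiv_mult using zc Pz by (simp add: pderiv_pCons field_simps)
  then have "z * poly (pderiv Q) z / poly Q z + of_real (real (degree Q) * q)
    = (z * poly (pderiv P) z / poly P z + of_real (real (degree P) * q))
      - (z / c / (1 - z / c) - of_real q)"
    unfolding u by (simp add: dQ algebra_simps)
  then have "norm (z * poly (pderiv Q) z / poly Q z + of_real (real (degree Q) * q))
      \<le> real (degree P) * d + d"
    using norm_triangle_ineq4 IH B by (smt (verit))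
  then show ?case unfolding q_def[symmetric] d_def[symmetric] dQ by (simp add: algebra_simps)
qed

section \<open>Power branches, products and dilations\<close>

text \<open>Differentiating \<open>exp (L z) = q z\<close> gives L' = q'/q, so the derivative of the
  branch can be expressed without the logarithm \<open>L\<close>.\<close>

lemma is_power_branch_has_derivative:
  assumes g: "is_power_branch q c g" and z: "z \<in> ball 0 1"
    and q: "(q has_field_derivative q') (at z)"
  shows "g z \<noteq> 0" "(g has_field_derivative g z * (of_real c * (q' / q z))) (at z)"
proof -
  obtain L where L: "L holomorphic_on ball 0 1"
      "\<And>z. z \<in> ball 0 1 \<Longrightarrow> exp (L z) = q z"
      "\<And>z. z \<in> ball 0 1 \<Longrightarrow> g z = exp (of_real c * L z)"
    using g unfolding is_power_branch_def by blast
  show "g z \<noteq> 0" using L(3)[OF z] by simp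
  have d: "(L has_field_derivative deriv L z) (at z)"
    using L(1) z by (simp add: holomorphic_derivI)
  then have "((\<lambda>z. exp (L z)) has_field_derivative exp (L z) * deriv L z) (at z)"
    by (auto intro!: derivative_eq_intros)
  then have "(q has_field_derivative exp (L z) * deriv L z) (at z)"
    by (rule has_field_derivative_transform_within_open[OF _ open_ball z]) (rule L(2))
  then have "q' = exp (L z) * deriv L z" using q DERIV_unique by blast
  then have dL: "deriv L z = q' / q z" using L(2)[OF z] by (metis exp_not_eq_zero nonzero_mult_div_cancel_left)
  have "((\<lambda>z. exp (of_real c * L z)) has_field_derivative
      exp (of_real c * L z) * (of_real c * deriv L z)) (at z)"
    using d by (auto intro!: derivative_eq_intros)
  then have "(g has_field_derivative exp (of_real c * L z) * (of_real c * deriv L z)) (at z)"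
    by (rule has_field_derivative_transform_within_open[OF _ open_ball z]) (simp add: L(3))
  then show "(g has_field_derivative g z * (of_real c * (q' / q z))) (at z)"
    using L(3)[OF z] dL by simp
qed

lemma is_power_branch_at_0:
  assumes "is_power_branch q c g"
  shows "g 0 = 1"
proof -
  have "(0::complex) \<in> ball 0 1" by simp
  then show ?thesis using assms unfolding is_power_branch_def by (metis exp_zero mult_zero_right)
qed

lemma class_A_mult_power_branch:
  assumes f: "f \<in> class_A" and nz: "\<And>z. z \<in> ball 0 1 \<Longrightarrow> z \<noteq> 0 \<Longrightarrow> f z \<noteq> 0"
    and g: "is_power_branch (poly Q) c g"
    and F: "\<And>z. z \<in> ball 0 1 \<Longrightarrow> F z = f z * g z"
  shows "F \<in> class_A" "\<And>z. z \<in> ball 0 1 \<Longrightarrow> z \<noteq> 0 \<Longrightarrow> F z \<noteq> 0"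
    "\<And>z. z \<in> ball 0 1 \<Longrightarrow>
      zlogderiv F z = zlogderiv f z + of_real c * (z * poly (pderiv Q) z / poly Q z)"
proof -
  have f': "f holomorphic_on ball 0 1" "f 0 = 0" "deriv f 0 = 1"
    using f by (auto simp: class_A_def)
  note gd = is_power_branch_has_derivative[OF g _ poly_DERIV]
  \<comment> \<open>\<open>F\<close> is constrained only on the disc, so its derivative is
    transferred from the product through the open ball.\<close>
  have dF: "(F has_field_derivative
      deriv f z * g z + f z * (g z * (of_real c * (poly (pderiv Q) z / poly Q z)))) (at z)"
    if z: "z \<in> ball 0 1" for z
  proof -
    have "(f has_field_derivative deriv f z) (at z)"
      using f'(1) z by (simp add: holomorphic_derivI)
    then have "((\<lambda>z. f z * g z) has_field_derivative
      deriv f z * g z + f z * (g z * (of_real c * (poly (pderiv Q) z / poly Q z)))) (at z)"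
      using gd(2)[OF z] by (auto intro!: derivative_eq_intros)
    then show ?thesis
      by (rule has_field_derivative_transform_within_open[OF _ open_ball z]) (simp add: F)
  qed
  have "deriv F 0 = 1"
    using DERIV_imp_deriv[OF dF[of 0]] f'(2,3) is_power_branch_at_0[OF g] by simp
  moreover have "F holomorphic_on ball 0 1"
    unfolding holomorphic_on_def field_differentiable_def
    using dF has_field_derivative_at_within by blast
  ultimately show "F \<in> class_A" using f'(2) F[of 0] by (simp add: class_A_def)
  show Fnz: "F z \<noteq> 0" if "z \<in> ball 0 1" "z \<noteq> 0" for z
    using that F nz gd(1) by simp
  show "zlogderiv F z = zlogderiv f z + of_real c * (z * poly (pderiv Q) z / poly Q z)"
    if z: "z \<in> ball 0 1" for z
  proof (cases "z = 0")
    case False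
    show ?thesis
      using False nz[OF z False] gd(1)[OF z] F[OF z]
      unfolding zlogderiv_def DERIV_imp_deriv[OF dF[OF z]] by (simp add: field_simps)
  qed (simp add: zlogderiv_def)
qed

text \<open>The factor 1/r cancels the chain-rule factor r, so passing to \<open>h\<close> merely
  evaluates the quotient of \<open>f\<close> at the dilated point.\<close>

lemma zlogderiv_rescale:
  assumes f: "f \<in> class_A" and r: "0 < r" "r < 1"
  defines "h \<equiv> \<lambda>z. f (of_real r * z) / of_real r"
  shows "h \<in> class_A" "\<And>z. z \<in> ball 0 1 \<Longrightarrow> zlogderiv h z = zlogderiv f (of_real r * z)"
proof -
  have f': "f holomorphic_on ball 0 1" "f 0 = 0" "deriv f 0 = 1"
    using f by (auto simp: class_A_def)
  have in_ball: "of_real r * z \<in> ball 0 1" if "z \<in> ball 0 1" for z :: complex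
    using that r mult_strict_mono'[of r 1 "norm z" 1] by (simp add: norm_mult)
  have dh: "(h has_field_derivative deriv f (of_real r * z)) (at z)" if z: "z \<in> ball 0 1" for z
  proof -
    have "(f has_field_derivative deriv f (of_real r * z)) (at (of_real r * z))"
      using f'(1) in_ball[OF z] holomorphic_derivI open_ball by blast
    then have "((\<lambda>z. f (of_real r * z)) has_field_derivative deriv f (of_real r * z) * of_real r) (at z)"
      by (rule DERIV_chain2) (auto intro!: derivative_eq_intros)
    then show ?thesis unfolding h_def using r by (auto intro!: derivative_eq_intros)
  qed
  have "h holomorphic_on ball 0 1"
    unfolding holomorphic_on_def field_differentiable_def
    using dh has_field_derivative_at_within by blast
  then show "h \<in> class_A"
    using DERIV_imp_deriv[OF dh[of 0]] f' by (simp add: class_A_def h_def)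
  show "zlogderiv h z = zlogderiv f (of_real r * z)" if z: "z \<in> ball 0 1" for z
    unfolding zlogderiv_def DERIV_imp_deriv[OF dh[OF z]] using r by (simp add: h_def)
qed

section \<open>Criteria for and against membership in \<open>exp_starlike\<close>\<close>

text \<open>The subordinating function is the principal logarithm of the quotient: it is holomorphic
  since the disc lies in the right half-plane, vanishes at 0 since the quotient is 1 there, and is
  bounded by \<open>norm_Ln_less_one\<close>.\<close>

lemma exp_starlikeI:
  assumes h: "h \<in> class_A"
    and disc: "\<And>z. z \<in> ball 0 1 \<Longrightarrow> norm (zlogderiv h z - of_real (cosh 1)) < sinh 1"
  shows "h \<in> exp_starlike"
proof -
  note Ln = norm_Ln_less_one[OF disc]
  have nz: "h z \<noteq> 0" if "z \<in> ball 0 1" "z \<noteq> 0" for z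
    using Ln(1)[OF that(1)] that(2) by (auto simp: zlogderiv_def)
  have hol: "zlogderiv h holomorphic_on ball 0 1"
    using h nz by (rule zlogderiv_holomorphic)
  have "(\<lambda>z. Ln (zlogderiv h z)) holomorphic_on ball 0 1"
    using hol Ln(1) by (intro holomorphic_intros) (fastforce simp: complex_nonpos_Reals_iff)+
  moreover have "exp (Ln (zlogderiv h z)) = zlogderiv h z" if "z \<in> ball 0 1" for z
    using Ln(1)[OF that] by (intro exp_Ln) auto
  moreover have "Ln (zlogderiv h 0) = 0" by (simp add: zlogderiv_def)
  ultimately have "subordinate (zlogderiv h) exp"
    unfolding subordinate_def using hol Ln(2)
    by (intro conjI exI[of _ "\<lambda>z. Ln (zlogderiv h z)"]) (auto intro!: holomorphic_intros)
  then show ?thesis using h by (simp add: exp_starlike_def)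
qed

text \<open>Moduli decide: |exp w| = exp (Re w) with |Re w| \<le> |w| < 1 lies strictly between 1/e
  and e.\<close>

lemma not_exp_starlikeI:
  assumes "z \<in> ball 0 1" "zlogderiv h z = of_real (exp a)" "1 \<le> \<bar>a\<bar>"
  shows "h \<notin> exp_starlike"
proof
  assume "h \<in> exp_starlike"
  then obtain w where "w ` ball 0 1 \<subseteq> ball 0 1" "zlogderiv h z = exp (w z)"
    using assms(1) unfolding exp_starlike_def subordinate_def by blast
  then have "norm (w z) < 1" "norm (exp (w z)) = norm (of_real (exp a) :: complex)"
    using assms(1,2) by (simp_all add: image_subset_iff)
  then have "\<bar>a\<bar> < 1" using abs_Re_le_cmod[of "w z"] by simp
  then show False using assms(3) by simp
qed

section \<open>The two quadratics and the meaning of the sign of \<open>X_fun\<close>\<close>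

text \<open>With \<open>a\<close> and \<open>\<rho>\<close> as above, these are \<open>e (1 - t^2) (a - \<rho> - 1/e)\<close> and
  \<open>(1 - t^2) (e - a - \<rho>)\<close>.\<close>
definition lower_poly :: "real \<Rightarrow> real \<Rightarrow> real \<Rightarrow> real" where
  "lower_poly \<alpha> \<beta> t = (1 - exp 1 * (2 * \<alpha> - 1 + \<beta>)) * t\<^sup>2
    - exp 1 * (2 - 2 * \<alpha> + \<beta>) * t + (exp 1 - 1)"

definition upper_poly :: "real \<Rightarrow> real \<Rightarrow> real \<Rightarrow> real" where
  "upper_poly \<alpha> \<beta> t = (2 * \<alpha> - 1 + \<beta> - exp 1) * t\<^sup>2
    - (2 - 2 * \<alpha> + \<beta>) * t + (exp 1 - 1)"

lemma \<sigma>0_root: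
  assumes "0 < \<beta>"
  shows "0 < \<sigma>0 \<alpha> \<beta>" "\<sigma>0 \<alpha> \<beta> < 1" "lower_poly \<alpha> \<beta> (\<sigma>0 \<alpha> \<beta>) = 0"
    "\<And>t. 0 \<le> t \<Longrightarrow> t \<le> 1 \<Longrightarrow> 0 < lower_poly \<alpha> \<beta> t \<longleftrightarrow> t < \<sigma>0 \<alpha> \<beta>"
proof -
  let ?A = "1 - exp 1 * (2 * \<alpha> - 1 + \<beta>)"
  let ?B = "exp 1 * (2 - 2 * \<alpha> + \<beta>)"
  \<comment> \<open>This is the value of \<open>lower_poly\<close> at 1; its negativity comes from
    \<beta> > 0.\<close>
  have "?A - ?B + (exp 1 - 1) = - (2 * exp 1 * \<beta>)" by (simp add: algebra_simps)
  also have "\<dots> < 0" using assms by simp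
  finally have neg: "?A - ?B + (exp 1 - 1) < 0" .
  have C: "0 < exp 1 - (1::real)" by simp
  have eq: "\<sigma>0 \<alpha> \<beta> = 2 * (exp 1 - 1) / (?B + sqrt (?B\<^sup>2 - 4 * (exp 1 - 1) * ?A))"
    by (simp add: \<sigma>0_def Let_def)
  note root = quadratic_root_sign[OF C neg]
  show "0 < \<sigma>0 \<alpha> \<beta>" "\<sigma>0 \<alpha> \<beta> < 1" unfolding eq by (fact root(1,2))+
  show "lower_poly \<alpha> \<beta> (\<sigma>0 \<alpha> \<beta>) = 0" unfolding eq lower_poly_def by (fact root(3))
  show "0 < lower_poly \<alpha> \<beta> t \<longleftrightarrow> t < \<sigma>0 \<alpha> \<beta>" if "0 \<le> t" "t \<le> 1" for t
    unfolding eq lower_poly_def using that by (rule root(4))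
qed

lemma \<sigma>0_tilde_root:
  assumes "\<alpha> < 1"
  shows "0 < \<sigma>0_tilde \<alpha> \<beta>" "\<sigma>0_tilde \<alpha> \<beta> < 1" "upper_poly \<alpha> \<beta> (\<sigma>0_tilde \<alpha> \<beta>) = 0"
    "\<And>t. 0 \<le> t \<Longrightarrow> t \<le> 1 \<Longrightarrow> 0 < upper_poly \<alpha> \<beta> t \<longleftrightarrow> t < \<sigma>0_tilde \<alpha> \<beta>"
proof -
  let ?A = "2 * \<alpha> - 1 + \<beta> - exp 1"
  let ?B = "2 - 2 * \<alpha> + \<beta>"
  \<comment> \<open>The value of \<open>upper_poly\<close> at 1 is -4(1 - \<alpha>), negative
    because \<alpha> < 1.\<close>
  have neg: "?A - ?B + (exp 1 - 1) < 0" using assms by simp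
  have C: "0 < exp 1 - (1::real)" by simp
  have eq: "\<sigma>0_tilde \<alpha> \<beta> = 2 * (exp 1 - 1) / (?B + sqrt (?B\<^sup>2 - 4 * (exp 1 - 1) * ?A))"
    by (simp add: \<sigma>0_tilde_def Let_def)
  note root = quadratic_root_sign[OF C neg]
  show "0 < \<sigma>0_tilde \<alpha> \<beta>" "\<sigma>0_tilde \<alpha> \<beta> < 1" unfolding eq by (fact root(1,2))+
  show "upper_poly \<alpha> \<beta> (\<sigma>0_tilde \<alpha> \<beta>) = 0" unfolding eq upper_poly_def by (fact root(3))
  show "0 < upper_poly \<alpha> \<beta> t \<longleftrightarrow> t < \<sigma>0_tilde \<alpha> \<beta>" if "0 \<le> t" "t \<le> 1" for t
    unfolding eq upper_poly_def using that by (rule root(4))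
qed

text \<open>Multiplying by e makes the linear terms cancel, so comparing the two conditions involves
  only t^2. At a root of either quadratic this identity gives the sign of the other.\<close>

lemma upper_lower_poly_diff:
  "exp 1 * upper_poly \<alpha> \<beta> t - lower_poly \<alpha> \<beta> t
    = (exp 1 - 1)\<^sup>2 - (1 + (exp 1)\<^sup>2 - 2 * exp 1 * (2 * \<alpha> + \<beta> - 1)) * t\<^sup>2"
  unfolding upper_poly_def lower_poly_def by (simp add: power2_eq_square algebra_simps)

text \<open>\<open>X_fun\<close> is a positive multiple of \<open>lower_poly\<close> at
  \<open>\<sigma>0_tilde\<close>: the square root is first expressed through that root
  \<open>\<tau>\<close>, then \<open>upper_poly\<close> vanishing at \<open>\<tau>\<close> removes
  the linear term.\<close>

lemma X_fun_pos_iff: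
  assumes \<alpha>: "\<alpha> < 1" and neg: "2 * \<alpha> + \<beta> - 2 < 0"
  shows "0 < X_fun \<alpha> \<beta> \<longleftrightarrow> 0 < lower_poly \<alpha> \<beta> (\<sigma>0_tilde \<alpha> \<beta>)"
proof -
  define e :: real where "e = exp 1"
  define s where "s = 2 * \<alpha> + \<beta> - 1"
  define B where "B = 2 - 2 * \<alpha> + \<beta>"
  define K where "K = 1 + e\<^sup>2 - 2 * e * s"
  define \<tau> where "\<tau> = \<sigma>0_tilde \<alpha> \<beta>"
  define S where "S = sqrt (B\<^sup>2 - 4 * (e - 1) * (s - e))"
  have e1: "1 < e" by (simp add: e_def)
  have s1: "s < 1" using neg by (simp add: s_def)
  have up: "(s - e) * \<tau>\<^sup>2 - B * \<tau> + (e - 1) = 0"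
    using \<sigma>0_tilde_root(3)[OF \<alpha>, of \<beta>] by (simp add: upper_poly_def e_def s_def B_def \<tau>_def algebra_simps)
  have "0 < 4 * (e - 1) * (e - s)" using e1 s1 by simp
  then have "B\<^sup>2 < B\<^sup>2 - 4 * (e - 1) * (s - e)" by (simp add: algebra_simps)
  then have S2: "S\<^sup>2 = B\<^sup>2 - 4 * (e - 1) * (s - e)" and "\<bar>B\<bar> < S"
    unfolding S_def by (smt (verit) real_sqrt_pow2 zero_le_power2, metis power2_abs real_less_rsqrt)
  then have BS: "0 < B + S" by linarith
  have \<tau>: "\<tau> = 2 * (e - 1) / (B + S)"
    unfolding \<tau>_def \<sigma>0_tilde_def Let_def S_def B_def s_def e_def by (simp add: algebra_simps)
  \<comment> \<open>Rationalising replaces the bracket \<open>B - S\<close> of \<open>X_fun\<close>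
    by a multiple of \<open>\<tau>\<close>.\<close>
  have "(B - S) * (B + S) = 4 * (e - 1) * (s - e)"
    using S2 by (simp add: power2_eq_square algebra_simps)
  then have BmS: "B - S = 2 * (s - e) * \<tau>" unfolding \<tau> using BS by (simp add: field_simps)
  have "X_fun \<alpha> \<beta> = 2 * B * K * (B - S) + 4 * (s - e) * (e\<^sup>2 - 1) * (s - 1)"
    unfolding X_fun_def Let_def S_def B_def K_def s_def e_def by (simp add: algebra_simps)
  also have "\<dots> = 4 * (s - e) * (K * (B * \<tau>) + (e\<^sup>2 - 1) * (s - 1))"
    unfolding BmS by (simp add: algebra_simps)
  also have "B * \<tau> = (s - e) * \<tau>\<^sup>2 + (e - 1)" using up by simp
  also have "4 * (s - e) * (K * ((s - e) * \<tau>\<^sup>2 + (e - 1)) + (e\<^sup>2 - 1) * (s - 1))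
      = 4 * (s - e)\<^sup>2 * (K * \<tau>\<^sup>2 - (e - 1)\<^sup>2)"
    unfolding K_def by algebra
  also have "K * \<tau>\<^sup>2 - (e - 1)\<^sup>2 = lower_poly \<alpha> \<beta> \<tau>"
    using upper_lower_poly_diff[of \<alpha> \<beta> \<tau>] \<sigma>0_tilde_root(3)[OF \<alpha>, of \<beta>]
    by (simp add: K_def e_def s_def \<tau>_def)
  finally have "X_fun \<alpha> \<beta> = 4 * (s - e)\<^sup>2 * lower_poly \<alpha> \<beta> \<tau>" .
  moreover have "0 < 4 * (s - e)\<^sup>2" using s1 e1 by simp
  ultimately show ?thesis unfolding \<tau>_def by (simp add: zero_less_mult_iff)
qed

text \<open>For 2\<alpha> + \<beta> \<ge> 2 the quadratic \<open>upper_poly\<close> is still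
  positive at \<open>\<sigma>0\<close>, so \<open>\<sigma>0\<close> is the smaller number. Otherwise
  X > 0 means that \<open>lower_poly\<close> is positive at \<open>\<sigma>0_tilde\<close>, that is,
  that \<open>\<sigma>0_tilde\<close> lies below \<open>\<sigma>0\<close>.\<close>

lemma radius_eq_min:
  assumes \<alpha>: "\<alpha> < 1" and \<beta>: "0 < \<beta>"
  shows "(if 2 * \<alpha> + \<beta> - 2 \<ge> 0 then \<sigma>0 \<alpha> \<beta>
     else if X_fun \<alpha> \<beta> \<le> 0 then \<sigma>0 \<alpha> \<beta>
     else \<sigma>0_tilde \<alpha> \<beta>) = min (\<sigma>0 \<alpha> \<beta>) (\<sigma>0_tilde \<alpha> \<beta>)"
proof (cases "2 * \<alpha> + \<beta> - 2 \<ge> 0")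
  case True
  let ?\<sigma> = "\<sigma>0 \<alpha> \<beta>"
  have \<sigma>: "0 < ?\<sigma>" "?\<sigma> < 1" by (fact \<sigma>0_root[OF \<beta>])+
  have "1 + (exp 1)\<^sup>2 - 2 * exp 1 * (2 * \<alpha> + \<beta> - 1)
      = (exp 1 - 1)\<^sup>2 - 2 * exp 1 * (2 * \<alpha> + \<beta> - 2)"
    by (simp add: power2_eq_square algebra_simps)
  also have "\<dots> \<le> (exp 1 - 1)\<^sup>2" using True by simp
  finally have "(1 + (exp 1)\<^sup>2 - 2 * exp 1 * (2 * \<alpha> + \<beta> - 1)) * ?\<sigma>\<^sup>2 \<le> (exp 1 - 1)\<^sup>2 * ?\<sigma>\<^sup>2"
    by (intro mult_right_mono) auto
  also have "\<dots> < (exp 1 - 1)\<^sup>2 * 1"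
    using \<sigma> by (intro mult_strict_left_mono) (auto simp: power_less_one_iff abs_square_less_1)
  finally have "0 < exp 1 * upper_poly \<alpha> \<beta> ?\<sigma>"
    using upper_lower_poly_diff[of \<alpha> \<beta> ?\<sigma>] \<sigma>0_root(3)[OF \<beta>, of \<alpha>] by linarith
  then have "?\<sigma> < \<sigma>0_tilde \<alpha> \<beta>"
    using \<sigma>0_tilde_root(4)[OF \<alpha>, of ?\<sigma> \<beta>] \<sigma> by (simp add: zero_less_mult_iff)
  then show ?thesis using True by simp
next
  case False
  have "0 < X_fun \<alpha> \<beta> \<longleftrightarrow> \<sigma>0_tilde \<alpha> \<beta> < \<sigma>0 \<alpha> \<beta>"
    using X_fun_pos_iff[OF \<alpha>, of \<beta>] False \<sigma>0_root(4)[OF \<beta>] \<sigma>0_tilde_root(1,2)[OF \<alpha>, of \<beta>]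
    by simp
  then show ?thesis using False by auto
qed

section \<open>Exponential starlikeness below both numbers\<close>

text \<open>Centres and radii of the discs for \<open>f\<close> and \<open>Q\<close> add; the
  exponent \<beta>/n cancels the degree n, so the result depends on \<beta> alone.\<close>

lemma family_F_disc:
  assumes F: "F \<in> family_F \<alpha> \<beta> n" and \<alpha>: "0 \<le> \<alpha>" "\<alpha> < 1" and \<beta>: "0 < \<beta>"
    and n: "1 \<le> n"
  shows "F \<in> class_A"
    "\<And>z. z \<in> ball 0 1 \<Longrightarrow>
      norm (zlogderiv F z - of_real ((1 - (2 * \<alpha> - 1 + \<beta>) * (norm z)\<^sup>2) / (1 - (norm z)\<^sup>2)))
      \<le> (2 - 2 * \<alpha> + \<beta>) * norm z / (1 - (norm z)\<^sup>2)"
proof -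
  obtain f Q g where f: "f \<in> class_ST \<alpha>" and Q: "degree Q = n" "\<And>z. poly Q z = 0 \<Longrightarrow> z \<notin> ball 0 1"
    and g: "is_power_branch (poly Q) (\<beta> / real n) g"
    and Fz: "\<And>z. z \<in> ball 0 1 \<Longrightarrow> F z = f z * g z"
    using F unfolding family_F_def by blast
  have fA: "f \<in> class_A" using f by (simp add: class_ST_def)
  note prod = class_A_mult_power_branch[OF fA class_ST_nonzero[OF f \<alpha>(1)] g Fz]
  show "F \<in> class_A" by (rule prod(1))
  fix z :: complex assume z: "z \<in> ball 0 1"
  define q where "q = (norm z)\<^sup>2 / (1 - (norm z)\<^sup>2)"
  define d where "d = norm z / (1 - (norm z)\<^sup>2)"
  define T where "T = z * poly (pderiv Q) z / poly Q z"
  have t2: "0 < 1 - (norm z)\<^sup>2" using z by (simp add: power_less_one_iff abs_square_less_1)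
  have c: "(1 - (2 * \<alpha> - 1 + \<beta>) * (norm z)\<^sup>2) / (1 - (norm z)\<^sup>2) = 1 + 2 * (1 - \<alpha>) * q - \<beta> * q"
  proof -
    have "1 / (1 - (norm z)\<^sup>2) = 1 + q" unfolding q_def using t2 by (simp add: divide_eq_eq distrib_right)
    then have "(1 - (2 * \<alpha> - 1 + \<beta>) * (norm z)\<^sup>2) / (1 - (norm z)\<^sup>2)
        = 1 + q - (2 * \<alpha> - 1 + \<beta>) * q"
      by (simp only: diff_divide_distrib q_def times_divide_eq_right)
    then show ?thesis by (simp add: algebra_simps)
  qed
  have A: "norm (zlogderiv f z - 1 - of_real (2 * (1 - \<alpha>) * q)) \<le> 2 * (1 - \<alpha>) * d"
    unfolding q_def d_def by (rule class_ST_disc[OF f \<alpha> z])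
  have "norm (T + of_real (real n * q)) \<le> real n * d"
    unfolding q_def d_def T_def Q(1)[symmetric] by (rule poly_logderiv_disc[OF Q(2) z])
  then have B: "norm (of_real (\<beta> / real n) * (T + of_real (real n * q))) \<le> (\<beta> / real n) * (real n * d)"
    unfolding norm_mult norm_of_real using \<beta> by (intro mult_mono) auto
  have zF: "zlogderiv F z = zlogderiv f z + of_real (\<beta> / real n) * T"
    unfolding T_def by (rule prod(3)) (use z in simp_all)
  have "zlogderiv F z - of_real (1 + 2 * (1 - \<alpha>) * q - \<beta> * q)
      = (zlogderiv f z - 1 - of_real (2 * (1 - \<alpha>) * q))
        + of_real (\<beta> / real n) * (T + of_real (real n * q))"
    unfolding zF using n by (simp add: field_simps)
  then have "norm (zlogderiv F z - of_real (1 + 2 * (1 - \<alpha>) * q - \<beta> * q))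
      \<le> 2 * (1 - \<alpha>) * d + (\<beta> / real n) * (real n * d)"
    by (simp only: norm_triangle_le[OF add_mono[OF A B]])
  also have "\<dots> = (2 - 2 * \<alpha> + \<beta>) * norm z / (1 - (norm z)\<^sup>2)"
    unfolding d_def using n by (simp add: add_divide_distrib diff_divide_distrib ring_distribs)
  finally show "norm (zlogderiv F z
      - of_real ((1 - (2 * \<alpha> - 1 + \<beta>) * (norm z)\<^sup>2) / (1 - (norm z)\<^sup>2)))
      \<le> (2 - 2 * \<alpha> + \<beta>) * norm z / (1 - (norm z)\<^sup>2)"
    unfolding c .
qed

lemma family_F_exp_starlike:
  assumes F: "F \<in> family_F \<alpha> \<beta> n" and \<alpha>: "0 \<le> \<alpha>" "\<alpha> < 1" and \<beta>: "0 < \<beta>"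
    and n: "1 \<le> n" and r: "0 < r" "r < min (\<sigma>0 \<alpha> \<beta>) (\<sigma>0_tilde \<alpha> \<beta>)"
  shows "(\<lambda>z. F (of_real r * z) / of_real r) \<in> exp_starlike"
proof -
  note F' = family_F_disc[OF F \<alpha> \<beta> n]
  have r1: "r < 1" using r \<sigma>0_root(2)[OF \<beta>, of \<alpha>] by simp
  note resc = zlogderiv_rescale[OF F'(1) r(1) r1]
  show ?thesis
  proof (rule exp_starlikeI[OF resc(1)])
    fix z :: complex assume z: "z \<in> ball 0 1"
    define y where "y = of_real r * z"
    define t where "t = norm y"
    define a where "a = (1 - (2 * \<alpha> - 1 + \<beta>) * t\<^sup>2) / (1 - t\<^sup>2)"
    define \<rho> where "\<rho> = (2 - 2 * \<alpha> + \<beta>) * t / (1 - t\<^sup>2)"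
    have t: "0 \<le> t" "t \<le> r"
      using z r(1) by (auto simp: t_def y_def norm_mult mult_left_le)
    then have t1: "t < 1" using r1 by simp
    then have y: "y \<in> ball 0 1" by (simp add: t_def)
    have t2: "0 < 1 - t\<^sup>2" using t t1 by (simp add: power_less_one_iff abs_square_less_1)
    have pos: "0 < lower_poly \<alpha> \<beta> t" "0 < upper_poly \<alpha> \<beta> t"
      using \<sigma>0_root(4)[OF \<beta>, of t \<alpha>] \<sigma>0_tilde_root(4)[OF \<alpha>(2), of t \<beta>] t t1 r(2) by auto
    \<comment> \<open>Equations free of division, from which \<open>algebra\<close> can derive the
      next two identities.\<close>
    have clear: "(1 - t\<^sup>2) * a = 1 - (2 * \<alpha> - 1 + \<beta>) * t\<^sup>2"
      "(1 - t\<^sup>2) * \<rho> = (2 - 2 * \<alpha> + \<beta>) * t" "exp 1 * exp (- 1) = (1::real)"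
      unfolding a_def \<rho>_def using t2 by (simp_all add: exp_minus)
    have lower: "lower_poly \<alpha> \<beta> t = exp 1 * (1 - t\<^sup>2) * (a - \<rho> - exp (- 1))"
      unfolding lower_poly_def using clear by algebra
    have upper: "upper_poly \<alpha> \<beta> t = (1 - t\<^sup>2) * (exp 1 - a - \<rho>)"
      unfolding upper_poly_def using clear by algebra
    have "0 < exp 1 * (1 - t\<^sup>2)" using t2 by simp
    then have ends: "exp (- 1) < a - \<rho>" "a + \<rho> < exp 1"
      using zero_less_mult_pos[OF pos(1)[unfolded lower]] zero_less_mult_pos[OF pos(2)[unfolded upper] t2]
      by simp_all
    have "norm (zlogderiv F y - of_real a) \<le> \<rho>"
      using F'(2)[OF y] by (simp only: t_def a_def \<rho>_def)
    then have "norm (zlogderiv F y - of_real (cosh 1)) \<le> \<rho> + \<bar>a - cosh 1\<bar>"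
      using norm_triangle_ineq[of "zlogderiv F y - of_real a" "of_real (a - cosh 1)"]
      by (simp only: norm_of_real) simp
    \<comment> \<open>The ends cosh 1 - sinh 1 and cosh 1 + sinh 1 are 1/e and e, so
      \<open>ends\<close> is exactly containment of one diameter in the other.\<close>
    also have "\<dots> < sinh 1" using ends by (auto simp: cosh_def sinh_def abs_if field_simps)
    finally show "norm (zlogderiv (\<lambda>z. F (of_real r * z) / of_real r) z - of_real (cosh 1)) < sinh 1"
      using resc(2)[OF z] by (simp add: y_def)
  qed
qed

section \<open>The extremal function and the upper bound for the radius\<close>

text \<open>Both disc estimates become equalities on the real axis when the Schwarz function of
  \<open>f\<close> is the identity and every root of \<open>Q\<close> is -1; this dictates the two
  witnesses.\<close>

lemma extremal_in_family_F:
  assumes \<alpha>: "0 \<le> \<alpha>" "\<alpha> < 1" and n: "1 \<le> n"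
  obtains F where "F \<in> family_F \<alpha> \<beta> n" "F \<in> class_A"
    "\<And>z. z \<in> ball 0 1 \<Longrightarrow>
      zlogderiv F z = 1 + of_real (2 * (1 - \<alpha>)) * (z / (1 - z)) + of_real \<beta> * (z / (1 + z))"
proof -
  define k where "k = 2 * (1 - \<alpha>)"
  define f where "f = (\<lambda>z. z * exp (- of_real k * Ln (1 - z)))"
  define Q :: "complex poly" where "Q = [:1, 1:] ^ n"
  \<comment> \<open>The inner product is the logarithm of \<open>Q\<close> vanishing at 0; it is
    left unsimplified to match \<open>is_power_branch\<close>.\<close>
  define g where "g = (\<lambda>z. exp (of_real (\<beta> / real n) * (of_nat n * Ln (1 + z))))"
  have slit: "1 - z \<notin> \<real>\<^sub>\<le>\<^sub>0" "1 + z \<notin> \<real>\<^sub>\<le>\<^sub>0" if "z \<in> ball 0 1" for z :: complex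
    using that abs_Re_le_cmod[of z] by (auto simp: complex_nonpos_Reals_iff)
  have nz: "1 - z \<noteq> 0" "1 + z \<noteq> 0" if "z \<in> ball 0 1" for z :: complex
    using slit[OF that] by auto
  have df: "(f has_field_derivative
      exp (- of_real k * Ln (1 - z)) * (1 + of_real k * (z / (1 - z)))) (at z)"
    if z: "z \<in> ball 0 1" for z
    unfolding f_def using slit[OF z] nz[OF z]
    by (auto intro!: derivative_eq_intros simp: field_simps)
  have fA: "f \<in> class_A"
  proof -
    have "f holomorphic_on ball 0 1"
      unfolding holomorphic_on_def field_differentiable_def
      using df has_field_derivative_at_within by blast
    then show ?thesis using DERIV_imp_deriv[OF df[of 0]] by (simp add: class_A_def f_def)
  qed
  have zf: "zlogderiv f z = 1 + of_real k * (z / (1 - z))" if z: "z \<in> ball 0 1" for z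
    unfolding zlogderiv_def DERIV_imp_deriv[OF df[OF z]] by (simp add: f_def)
  have fST: "f \<in> class_ST \<alpha>"
    unfolding class_ST_def
  proof (safe intro!: fA)
    fix z :: complex assume z: "z \<in> ball 0 1"
    have "(norm z)\<^sup>2 < 1" using z by (simp add: power_less_one_iff abs_square_less_1)
    then have "(Re z)\<^sup>2 + (Im z)\<^sup>2 < 1" by (simp add: cmod_power2)
    moreover have D: "0 < (1 - Re z)\<^sup>2 + (Im z)\<^sup>2"
      using nz(1)[OF z] by (auto simp: complex_eq_iff sum_power2_gt_zero_iff)
    \<comment> \<open>The map z/(1 - z) sends the unit disc into Re w > -1/2, and 1 - k/2 =
      \<alpha>.\<close>
    ultimately have "- 1 / 2 < Re (z / (1 - z))"
      by (simp add: Re_divide field_simps power2_eq_square)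
    then have "k * (- 1 / 2) < k * Re (z / (1 - z))"
      using \<alpha> by (intro mult_strict_left_mono) (auto simp: k_def)
    moreover have "Re (zlogderiv f z) = 1 + k * Re (z / (1 - z))"
      unfolding zf[OF z] by (simp only: plus_complex.sel times_complex.sel Re_complex_of_real Im_complex_of_real
          one_complex.sel mult_zero_left diff_zero)
    ultimately have "1 - k / 2 < Re (zlogderiv f z)" by simp
    then show "\<alpha> < Re (zlogderiv f z)" by (simp add: k_def field_simps)
  qed
  have Q': "poly Q z = (1 + z) ^ n" for z by (simp add: Q_def)
  have g: "is_power_branch (poly Q) (\<beta> / real n) g"
    unfolding is_power_branch_def
  proof (intro exI[of _ "\<lambda>z. of_nat n * Ln (1 + z)"] conjI ballI)
    show "(\<lambda>z. of_nat n * Ln (1 + z)) holomorphic_on ball 0 1"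
      using slit by (intro holomorphic_intros) auto
    fix z :: complex assume "z \<in> ball 0 1"
    then show "exp (of_nat n * Ln (1 + z)) = poly Q z"
      using nz by (simp add: exp_of_nat_mult Q')
  qed (simp_all add: g_def)
  have roots: "z \<notin> ball 0 1" if "poly Q z = 0" for z
    using that nz(2)[of z] by (auto simp: Q')
  have deg: "degree Q = n" by (simp add: Q_def degree_power_eq)
  show ?thesis
  proof (rule that[of "\<lambda>z. f z * g z"])
    show "(\<lambda>z. f z * g z) \<in> family_F \<alpha> \<beta> n"
      unfolding family_F_def mem_Collect_eq using fST g roots deg Q'
      by (intro bexI[of _ f] exI[of _ Q] exI[of _ g]) auto
    note prod = class_A_mult_power_branch[OF fA class_ST_nonzero[OF fST \<alpha>(1)] g refl]
    show "(\<lambda>z. f z * g z) \<in> class_A" by (rule prod(1))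
    fix z :: complex assume z: "z \<in> ball 0 1"
    have zfg: "zlogderiv (\<lambda>z. f z * g z) z
        = zlogderiv f z + of_real (\<beta> / real n) * (z * poly (pderiv Q) z / poly Q z)"
      by (rule prod(3)) (use z in simp_all)
    have "((\<lambda>z. (1 + z) ^ n) has_field_derivative of_nat n * (1 + z) ^ (n - 1)) (at z)"
      by (auto intro!: derivative_eq_intros)
    then have "poly (pderiv Q) z = of_nat n * (1 + z) ^ (n - 1)"
      using poly_DERIV[of Q z] DERIV_unique unfolding Q' by blast
    \<comment> \<open>As \<open>n\<close> is positive, the truncated \<open>n - 1\<close> is a true
      predecessor and the quotient Q'/Q reduces to n/(1 + z).\<close>
    moreover have "(1 + z) ^ n = (1 + z) * (1 + z) ^ (n - 1)"
      using n by (metis Suc_diff_1 One_nat_def Suc_le_lessD power_Suc)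
    ultimately show "zlogderiv (\<lambda>z. f z * g z) z
        = 1 + of_real (2 * (1 - \<alpha>)) * (z / (1 - z)) + of_real \<beta> * (z / (1 + z))"
      unfolding zfg zf[OF z] Q' k_def[symmetric] using nz(2)[OF z] n by simp
  qed
qed

lemma exp_starlike_up_to_family_F_le:
  assumes \<alpha>: "0 \<le> \<alpha>" "\<alpha> < 1" and \<beta>: "0 < \<beta>" and n: "1 \<le> n"
    and up: "exp_starlike_up_to (family_F \<alpha> \<beta> n) R" and R: "R < 1"
  shows "R \<le> \<sigma>0 \<alpha> \<beta>" "R \<le> \<sigma>0_tilde \<alpha> \<beta>"
proof -
  obtain F where F: "F \<in> family_F \<alpha> \<beta> n" "F \<in> class_A"
    and zF: "\<And>z. z \<in> ball 0 1 \<Longrightarrow>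
      zlogderiv F z = 1 + of_real (2 * (1 - \<alpha>)) * (z / (1 - z)) + of_real \<beta> * (z / (1 + z))"
    using extremal_in_family_F[OF \<alpha> n] by blast
  \<comment> \<open>If the quotient equals exp a with |a| \<ge> 1 at a real point x, a dilation by r
    with |x| < r < R moves that value to x/r inside the disc, which \<open>not_exp_starlikeI\<close>
    forbids.\<close>
  have no: "R \<le> \<bar>x\<bar>"
    if x: "x \<noteq> 0" "1 \<le> \<bar>a\<bar>" "1 + 2 * (1 - \<alpha>) * (x / (1 - x)) + \<beta> * (x / (1 + x)) = exp a"
    for x a :: real
  proof (rule ccontr)
    assume "\<not> R \<le> \<bar>x\<bar>"
    then obtain r where r: "\<bar>x\<bar> < r" "r < R" using dense[of "\<bar>x\<bar>" R] by auto
    have r0: "0 < r" "r < 1" using r R x by auto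
    define z where "z = complex_of_real (x / r)"
    have z: "z \<in> ball 0 1" using r r0 by (simp add: z_def norm_divide)
    have rz: "of_real r * z = of_real x" using r0 by (simp add: z_def)
    have "complex_of_real x \<in> ball 0 1" using r r0 by simp
    then have "zlogderiv F (of_real x)
        = of_real (1 + 2 * (1 - \<alpha>) * (x / (1 - x)) + \<beta> * (x / (1 + x)))"
      by (simp add: zF)
    then have "zlogderiv (\<lambda>z. F (of_real r * z) / of_real r) z = of_real (exp a)"
      unfolding zlogderiv_rescale(2)[OF F(2) r0 z] rz x(3) .
    then have "(\<lambda>z. F (of_real r * z) / of_real r) \<notin> exp_starlike"
      using not_exp_starlikeI[OF z] x(2) by blast
    then show False using up F(1) r r0 unfolding exp_starlike_up_to_def by blast
  qed
  show "R \<le> \<sigma>0 \<alpha> \<beta>"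
  proof -
    define s where "s = \<sigma>0 \<alpha> \<beta>"
    have s: "0 < s" "s < 1" "lower_poly \<alpha> \<beta> s = 0" unfolding s_def by (fact \<sigma>0_root[OF \<beta>])+
    have s2: "1 - s\<^sup>2 = (1 - s) * (1 + s)" by (simp add: power2_eq_square algebra_simps)
    have ne: "1 - s \<noteq> 0" "1 + s \<noteq> 0" using s by auto
    \<comment> \<open>Clearing denominators in "quotient at -s equals 1/e" leaves exactly
      \<open>lower_poly\<close>; at the positive point \<open>\<sigma>0_tilde\<close> the value e
      leads to \<open>upper_poly\<close> in the same way.\<close>
    have "exp 1 * ((1 - s) * (1 + s) - 2 * (1 - \<alpha>) * s * (1 - s) - \<beta> * s * (1 + s))
        - (1 - s) * (1 + s) = lower_poly \<alpha> \<beta> s"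
      unfolding lower_poly_def by (simp add: power2_eq_square algebra_simps)
    then have eq: "exp 1 * ((1 - s) * (1 + s) - 2 * (1 - \<alpha>) * s * (1 - s) - \<beta> * s * (1 + s))
        = (1 - s) * (1 + s)" using s by simp
    have "1 + 2 * (1 - \<alpha>) * (- s / (1 - - s)) + \<beta> * (- s / (1 + - s))
        = ((1 - s) * (1 + s) - 2 * (1 - \<alpha>) * s * (1 - s) - \<beta> * s * (1 + s)) / ((1 - s) * (1 + s))"
      using ne by (simp add: divide_simps) (simp add: algebra_simps)
    also have "\<dots> = exp (- 1)"
      using eq ne by (simp add: exp_minus divide_simps mult.commute)
    finally show ?thesis using no[of "- s" "- 1"] s by (simp add: s_def)
  qed
  show "R \<le> \<sigma>0_tilde \<alpha> \<beta>"
  proof -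
    define s where "s = \<sigma>0_tilde \<alpha> \<beta>"
    have s: "0 < s" "s < 1" "upper_poly \<alpha> \<beta> s = 0"
      unfolding s_def by (fact \<sigma>0_tilde_root[OF \<alpha>(2)])+
    have ne: "1 - s \<noteq> 0" "1 + s \<noteq> 0" using s by auto
    have "exp 1 * ((1 - s) * (1 + s))
        - ((1 - s) * (1 + s) + 2 * (1 - \<alpha>) * s * (1 + s) + \<beta> * s * (1 - s)) = upper_poly \<alpha> \<beta> s"
      unfolding upper_poly_def by (simp add: power2_eq_square algebra_simps)
    then have eq: "(1 - s) * (1 + s) + 2 * (1 - \<alpha>) * s * (1 + s) + \<beta> * s * (1 - s)
        = exp 1 * ((1 - s) * (1 + s))" using s by simp
    have "1 + 2 * (1 - \<alpha>) * (s / (1 - s)) + \<beta> * (s / (1 + s))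
        = ((1 - s) * (1 + s) + 2 * (1 - \<alpha>) * s * (1 + s) + \<beta> * s * (1 - s)) / ((1 - s) * (1 + s))"
      using ne by (simp add: divide_simps) (simp add: algebra_simps)
    also have "\<dots> = exp 1" unfolding eq using ne by simp
    finally show ?thesis using no[of s 1] s by (simp add: s_def)
  qed
qed

theorem theorem3p2:
  fixes \<alpha> \<beta> :: real and n :: nat
  assumes "0 \<le> \<alpha>" and "\<alpha> < 1" and "\<beta> > 0" and "n \<ge> 1"
  shows "is_exp_starlike_radius (family_F \<alpha> \<beta> n)
    (if 2 * \<alpha> + \<beta> - 2 \<ge> 0 then \<sigma>0 \<alpha> \<beta>
     else if X_fun \<alpha> \<beta> \<le> 0 then \<sigma>0 \<alpha> \<beta>
     else \<sigma>0_tilde \<alpha> \<beta>)"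
  unfolding radius_eq_min[OF assms(2,3)] is_exp_starlike_radius_def
proof (intro conjI ballI impI)
  show "min (\<sigma>0 \<alpha> \<beta>) (\<sigma>0_tilde \<alpha> \<beta>) \<in> {0<..<1}"
    using \<sigma>0_root(1,2)[OF assms(3), of \<alpha>] \<sigma>0_tilde_root(1,2)[OF assms(2), of \<beta>] by auto
  show "exp_starlike_up_to (family_F \<alpha> \<beta> n) (min (\<sigma>0 \<alpha> \<beta>) (\<sigma>0_tilde \<alpha> \<beta>))"
    unfolding exp_starlike_up_to_def using family_F_exp_starlike[OF _ assms] by blast
  fix R assume "R \<in> {0<..<1}" "exp_starlike_up_to (family_F \<alpha> \<beta> n) R"
  then show "R \<le> min (\<sigma>0 \<alpha> \<beta>) (\<sigma>0_tilde \<alpha> \<beta>)"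
    using exp_starlike_up_to_family_F_le[OF assms] by auto
qed

end
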